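(* Let $X$ be a path-connected topological group (whose underlying space is an ANR). Then for all integers $m\ge 1$, $\mathsf{iTC}_{m+1}(X)\le\mathsf{icat}(X^m)$.
   Context: All topological spaces are path-connected ANR spaces. $I=[0,1]$. For a metric space $Z$ and $n\ge 1$, $\mathcal B_n(Z)$ is the space of probability measures on $Z$ whose support has at most $n$ points, written as finite formal convex combinations $\sum\lambda_z z$ with $\lambda_z>0$, $\sum\lambda_z=1$, equipped with the Lévy–Prokhorov metric; $\delta_z$ is the Dirac measure at $z$. $P(Z)$ is the space of continuous paths $I\to Z$ with the compact-open topology. Define $\Phi_n:\mathcal B_n(P(X))\to P(\mathcal B_n(X))$ by $\Phi_n(\sum\lambda_\alpha\alpha)(t)=\sum\lambda_\alpha\alpha(t)$. A path $f\in P(\mathcal B_n(X))$ is resolvable if $f=\Phi_n(\mu)$ for some $\mu\in\mathcal B_n(P(X))$; $RP(\mathcal B_n(X))\subset P(\mathcal B_n(X))$ is the subspace of resolvable paths. Given a basepoint $x_0\in X$, $RP_0(\mathcal B_k(X))=\{f\in RP(\mathcal B_k(X)) : f(1)=\delta_{x_0}\}$. For $m\ge2$ let $t_i=(i-1)/(m-1)$, $1\le i\le m$. $\mathsf{iTC}_m(X)$ is the minimal integer $n\ge 0$ such that there is a continuous map $s_m:X^m\to RP(\mathcal B_{n+1}(X))$ with $s_m(x_1,\dots,x_m)(t_i)=\delta_{x_i}$ for all $1\le i\le m$ and all $(x_1,\dots,x_m)\in X^m$. $\mathsf{icat}(X)$ is the minimal integer $n\ge 0$ such that there is a continuous $H:X\to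 RP_0(\mathcal B_{n+1}(X))$ with $H(x)(0)=\delta_x$ for all $x\in X$. (Both are infinite if no such $n$ exists.) *)

theory Defs
  imports
    "HOL-Algebra.Group"
    "HOL-Analysis.Analysis"
    "HOL-Probability.Probability_Mass_Function"
    "HOL-Library.Extended_Nat"
begin

subsection \<open>Absolute neighbourhood retracts\<close>

text \<open>
  \<open>X\<close> is an ANR if it is metrizable and every homeomorphic copy of \<open>X\<close> that is closed in a
  metrizable space \<open>Z\<close> is a retract of one of its neighbourhoods in \<open>Z\<close>. HOL cannot quantify over
  the type of points of \<open>Z\<close> inside a definition. The type \<^typ>\<open>'a \<Rightarrow> real\<close> suffices: by the
  Kuratowski--Wojdyslawski theorem a metrizable \<open>X\<close> on the type \<^typ>\<open>'a\<close> is homeomorphic to a closed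
  subset of a convex set \<open>C\<close> of bounded functions on \<open>X\<close> (with the sup metric), and by Dugundji's
  theorem \<open>X\<close> is an ANR (for ambient spaces on any type) as soon as it is a neighbourhood retract
  of \<open>C\<close>. The library constant \<^const>\<open>ANR\<close> is only meant for subsets of Euclidean spaces.
\<close>

definition ANR_space :: "'a topology \<Rightarrow> bool" where
  "ANR_space X \<longleftrightarrow>
     metrizable_space X \<and>
     (\<forall>(Z :: ('a \<Rightarrow> real) topology) A.
        metrizable_space Z \<and> closedin Z A \<and> X homeomorphic_space subtopology Z A \<longrightarrow>
        (\<exists>U. openin Z U \<and> A \<subseteq> U \<and> A retract_of_space subtopology Z U))"


subsection \<open>Topological groups\<close>

definition topological_group :: "('a, 'b) monoid_scheme \<Rightarrow> 'a topology \<Rightarrow> bool" where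
  "topological_group G T \<longleftrightarrow>
     group G \<and> topspace T = carrier G \<and>
     continuous_map (prod_topology T T) T (\<lambda>(x, y). x \<otimes>\<^bsub>G\<^esub> y) \<and>
     continuous_map T T (\<lambda>x. inv\<^bsub>G\<^esub> x)"


subsection \<open>Finitely supported probability measures with the Levy--Prokhorov metric\<close>

text \<open>
  A probability measure with finite support is a \<open>pmf\<close>; the Dirac measure at \<open>z\<close> is
  \<open>return_pmf z\<close>, and \<open>map_pmf f\<close> sends \<open>\<Sum> \<lambda>\<^sub>z z\<close> to \<open>\<Sum> \<lambda>\<^sub>z f(z)\<close>, adding up the weights
  of points with the same image.
\<close>

definition fin_measures :: "nat \<Rightarrow> 'a set \<Rightarrow> 'a pmf set" where
  "fin_measures n S = {p. set_pmf p \<subseteq> S \<and> finite (set_pmf p) \<and> card (set_pmf p) \<le> n}"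

definition borel_sets_of :: "'a topology \<Rightarrow> 'a set set" where
  "borel_sets_of T = sigma_sets (topspace T) {U. openin T U}"

definition mnbhd :: "'a metric \<Rightarrow> 'a set \<Rightarrow> real \<Rightarrow> 'a set" where
  "mnbhd Z A \<epsilon> = {z \<in> mspace Z. \<exists>a\<in>A. mdist Z a z < \<epsilon>}"

definition lp_dist :: "'a metric \<Rightarrow> 'a pmf \<Rightarrow> 'a pmf \<Rightarrow> real" where
  "lp_dist Z p q = Inf {\<epsilon>. 0 < \<epsilon> \<and> (\<forall>A \<in> borel_sets_of (mtopology_of Z).
     measure_pmf.prob p A \<le> measure_pmf.prob q (mnbhd Z A \<epsilon>) + \<epsilon> \<and>
     measure_pmf.prob q A \<le> measure_pmf.prob p (mnbhd Z A \<epsilon>) + \<epsilon>)}"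

definition Bsp :: "nat \<Rightarrow> 'a metric \<Rightarrow> 'a pmf metric" where
  "Bsp n Z = metric (fin_measures n (mspace Z), lp_dist Z)"

text \<open>The pair in the definition of \<^const>\<open>Bsp\<close> really is a metric space.\<close>

context
  fixes Z :: "'a metric"
begin

private abbreviation good :: "'a pmf \<Rightarrow> 'a pmf \<Rightarrow> real set" where
  "good p q \<equiv> {\<epsilon>. 0 < \<epsilon> \<and> (\<forall>A \<in> borel_sets_of (mtopology_of Z).
     measure_pmf.prob p A \<le> measure_pmf.prob q (mnbhd Z A \<epsilon>) + \<epsilon> \<and>
     measure_pmf.prob q A \<le> measure_pmf.prob p (mnbhd Z A \<epsilon>) + \<epsilon>)}"

private lemma one_good: "1 \<in> good p q"
  by (auto intro!: order_trans[OF measure_pmf.prob_le_1])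

private lemma bdd_good: "bdd_below (good p q)"
  by (rule bdd_belowI[of _ 0]) auto

private lemma lp_le: "\<epsilon> \<in> good p q \<Longrightarrow> lp_dist Z p q \<le> \<epsilon>"
  unfolding lp_dist_def by (rule cInf_lower[OF _ bdd_good])

private lemma lp_nonneg: "0 \<le> lp_dist Z p q"
  unfolding lp_dist_def
proof (rule cInf_greatest)
  show "good p q \<noteq> {}"
    using one_good[of p q] by blast
qed auto

private lemma lp_commute: "lp_dist Z p q = lp_dist Z q p"
  unfolding lp_dist_def by (rule arg_cong[where f = Inf]) auto

private lemma lp_lessD:
  assumes "lp_dist Z p q < e"
  obtains \<epsilon> where "\<epsilon> \<in> good p q" "\<epsilon> < e"
  using cInf_lessD[of "good p q" e] one_good assms unfolding lp_dist_def by blast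

private lemma mnbhd_borel: "A \<subseteq> mspace Z \<Longrightarrow> mnbhd Z A \<epsilon> \<in> borel_sets_of (mtopology_of Z)"
proof -
  assume "A \<subseteq> mspace Z"
  then have "mnbhd Z A \<epsilon> = (\<Union>a\<in>A. Metric_space.mball (mspace Z) (mdist Z) a \<epsilon>)"
    by (auto simp: mnbhd_def Metric_space.in_mball subset_iff; blast)
  then have "openin (mtopology_of Z) (mnbhd Z A \<epsilon>)"
    by (auto simp: mtopology_of_def Metric_space.openin_mball)
  then show ?thesis
    by (auto simp: borel_sets_of_def)
qed

private lemma borel_subset: "A \<in> borel_sets_of (mtopology_of Z) \<Longrightarrow> A \<subseteq> mspace Z"
  unfolding borel_sets_of_def
  by (drule sigma_sets_into_sp[rotated]) (auto dest!: openin_subset)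

private lemma mnbhd_mnbhd:
  assumes "A \<subseteq> mspace Z"
  shows "mnbhd Z (mnbhd Z A \<delta>) \<epsilon> \<subseteq> mnbhd Z A (\<delta> + \<epsilon>)"
proof
  fix z assume "z \<in> mnbhd Z (mnbhd Z A \<delta>) \<epsilon>"
  then obtain y a where "z \<in> mspace Z" "y \<in> mspace Z" "a \<in> A" "mdist Z a y < \<delta>" "mdist Z y z < \<epsilon>"
    by (auto simp: mnbhd_def)
  moreover from this have "mdist Z a z \<le> mdist Z a y + mdist Z y z"
    using assms by (intro mdist_triangle) auto
  ultimately show "z \<in> mnbhd Z A (\<delta> + \<epsilon>)"
    unfolding mnbhd_def by (auto intro!: bexI[of _ a])
qed

private lemma good_add:
  assumes "\<delta> \<in> good p q" "\<epsilon> \<in> good q r"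
  shows "\<delta> + \<epsilon> \<in> good p r"
proof -
  have *: "measure_pmf.prob p A \<le> measure_pmf.prob r (mnbhd Z A (a + b)) + (a + b)"
    if A: "A \<in> borel_sets_of (mtopology_of Z)" and "a \<in> good p q" "b \<in> good q r" for A a b p q r
  proof -
    have "measure_pmf.prob p A \<le> measure_pmf.prob q (mnbhd Z A a) + a"
      using that by auto
    also have "measure_pmf.prob q (mnbhd Z A a) \<le> measure_pmf.prob r (mnbhd Z (mnbhd Z A a) b) + b"
      using that mnbhd_borel[OF borel_subset[OF A]] by auto
    also have "measure_pmf.prob r (mnbhd Z (mnbhd Z A a) b) \<le> measure_pmf.prob r (mnbhd Z A (a + b))"
      using mnbhd_mnbhd[OF borel_subset[OF A]] by (intro measure_pmf.finite_measure_mono) auto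
    finally show ?thesis by simp
  qed
  have "\<delta> \<in> good q p" "\<epsilon> \<in> good r q"
    using assms by auto
  then show ?thesis
    using assms *[of _ \<delta> p q \<epsilon> r] *[of _ \<epsilon> r q \<delta> p] by (auto simp: add.commute)
qed

private lemma lp_triangle: "lp_dist Z p r \<le> lp_dist Z p q + lp_dist Z q r"
proof (rule field_le_epsilon)
  fix e :: real assume "0 < e"
  then have "lp_dist Z p q < lp_dist Z p q + e / 2" "lp_dist Z q r < lp_dist Z q r + e / 2"
    by auto
  then obtain a b where "a \<in> good p q" "a < lp_dist Z p q + e / 2"
      and "b \<in> good q r" "b < lp_dist Z q r + e / 2"
    by (elim lp_lessD) blast
  then show "lp_dist Z p r \<le> lp_dist Z p q + lp_dist Z q r + e"
    using lp_le[OF good_add[of a p q b r]] by linarith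
qed

private lemma lp_self:
  assumes "set_pmf p \<subseteq> mspace Z"
  shows "lp_dist Z p p = 0"
proof -
  have good_self: "e \<in> good p p" if "0 < e" for e
  proof -
    have "measure_pmf.prob p A \<le> measure_pmf.prob p (mnbhd Z A e)"
      if "A \<in> borel_sets_of (mtopology_of Z)" for A
    proof (intro measure_pmf.finite_measure_mono subsetI)
      fix x assume "x \<in> A"
      then have "x \<in> mspace Z"
        using borel_subset[OF that] by auto
      moreover have "mdist Z x x < e"
        using iffD2[OF mdist_zero[OF \<open>x \<in> mspace Z\<close> \<open>x \<in> mspace Z\<close>] refl] \<open>0 < e\<close> by linarith
      ultimately show "x \<in> mnbhd Z A e"
        using \<open>x \<in> A\<close> by (auto simp: mnbhd_def)
    qed auto
    from add_increasing2[OF less_imp_le[OF \<open>0 < e\<close>] this] show ?thesis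
      using \<open>0 < e\<close> by blast
  qed
  have le: "lp_dist Z p p \<le> e" if "0 < e" for e
    by (rule lp_le[OF good_self[OF that]])
  have "lp_dist Z p p \<le> 0"
    by (rule field_le_epsilon) (simp only: add_0 le)
  then show ?thesis
    using lp_nonneg[of p p] by simp
qed

private lemma lp_zero_le:
  assumes "lp_dist Z p q = 0" "set_pmf p \<subseteq> mspace Z" "finite (set_pmf q)" "set_pmf q \<subseteq> mspace Z"
    and z: "z \<in> mspace Z"
  shows "pmf p z \<le> pmf q z"
proof (rule field_le_epsilon)
  fix e :: real assume "0 < e"
  define D where "D = insert e (mdist Z z ` (set_pmf q - {z}))"
  have D: "finite D" "D \<noteq> {}"
    using assms by (auto simp: D_def)
  have "\<forall>x\<in>D. 0 < x"
    using \<open>0 < e\<close> assms by (auto simp: D_def order_less_le)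
  then have "0 < Min D"
    using D by simp
  then obtain \<epsilon> where \<epsilon>: "\<epsilon> \<in> good p q" "\<epsilon> < Min D"
    using lp_lessD[of p q "Min D"] assms(1) by auto
  have "closedin (mtopology_of Z) {z}"
    unfolding mtopology_of_def using z
    by (simp add: Metric_space.t1_space_mtopology closedin_t1_singleton Metric_space.topspace_mtopology)
  then have "mspace Z - (mspace Z - {z}) \<in> borel_sets_of (mtopology_of Z)"
    unfolding borel_sets_of_def topspace_mtopology_of
    by (intro sigma_sets.Compl sigma_sets.Basic) (auto simp: closedin_def)
  then have "{z} \<in> borel_sets_of (mtopology_of Z)"
    using z by (simp add: Diff_Diff_Int)
  then have "pmf p z \<le> measure_pmf.prob q (mnbhd Z {z} \<epsilon>) + \<epsilon>"
    using \<epsilon> by (auto simp: measure_pmf_single[symmetric])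
  also have "measure_pmf.prob q (mnbhd Z {z} \<epsilon>) = measure_pmf.prob q (mnbhd Z {z} \<epsilon> \<inter> set_pmf q)"
    by (simp add: measure_Int_set_pmf)
  also have "mnbhd Z {z} \<epsilon> \<inter> set_pmf q \<subseteq> {z}"
  proof
    fix x assume x: "x \<in> mnbhd Z {z} \<epsilon> \<inter> set_pmf q"
    show "x \<in> {z}"
    proof (rule ccontr)
      assume "x \<notin> {z}"
      then have "Min D \<le> mdist Z z x"
        using x D by (intro Min_le) (auto simp: D_def)
      then show False
        using x \<epsilon>(2) by (auto simp: mnbhd_def)
    qed
  qed
  then have "measure_pmf.prob q (mnbhd Z {z} \<epsilon> \<inter> set_pmf q) \<le> measure_pmf.prob q {z}"
    by (intro measure_pmf.finite_measure_mono) auto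
  also have "measure_pmf.prob q {z} = pmf q z"
    by (simp add: measure_pmf_single)
  also have "\<epsilon> \<le> e"
    using \<epsilon>(2) D by (auto simp: D_def)
  finally show "pmf p z \<le> pmf q z + e" by simp
qed

lemma Metric_space_Bsp: "Metric_space (fin_measures n (mspace Z)) (lp_dist Z)"
proof
  fix p q r :: "'a pmf"
  show "0 \<le> lp_dist Z p q" by (rule lp_nonneg)
  show "lp_dist Z p q = lp_dist Z q p" by (rule lp_commute)
  show "lp_dist Z p r \<le> lp_dist Z p q + lp_dist Z q r" by (rule lp_triangle)
  assume pq: "p \<in> fin_measures n (mspace Z)" "q \<in> fin_measures n (mspace Z)"
  show "lp_dist Z p q = 0 \<longleftrightarrow> p = q"
  proof
    assume 0: "lp_dist Z p q = 0"
    show "p = q"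
    proof (rule pmf_eqI)
      fix z show "pmf p z = pmf q z"
      proof (cases "z \<in> mspace Z")
        case True
        then show ?thesis
          using lp_zero_le[of p q z] lp_zero_le[of q p z] 0 lp_commute[of p q] pq
          by (auto simp: fin_measures_def intro: antisym)
      next
        case False
        then show ?thesis
          using pq by (metis (mono_tags, lifting) fin_measures_def mem_Collect_eq pmf_eq_0_set_pmf subsetD)
      qed
    qed
  qed (use pq lp_self in \<open>auto simp: fin_measures_def\<close>)
qed

end

lemma mspace_Bsp [simp]: "mspace (Bsp n Z) = fin_measures n (mspace Z)"
  unfolding Bsp_def by (rule Metric_space.mspace_metric[OF Metric_space_Bsp])

lemma mdist_Bsp [simp]: "mdist (Bsp n Z) = lp_dist Z"
  unfolding Bsp_def by (rule Metric_space.mdist_metric[OF Metric_space_Bsp])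


subsection \<open>Path spaces and resolvable paths\<close>

text \<open>
  Paths are made extensional (fixed to \<open>undefined\<close> off \<open>[0,1]\<close>), so that distinct elements of
  \<open>paths T\<close> are distinct maps on the unit interval.
\<close>

definition paths :: "'a topology \<Rightarrow> (real \<Rightarrow> 'a) set" where
  "paths T = {g \<in> extensional {0..1}. pathin T g}"

definition path_space :: "'a topology \<Rightarrow> (real \<Rightarrow> 'a) topology" where
  "path_space T = topology_generated_by
     {{g \<in> paths T. g ` K \<subseteq> U} | K U. compactin (top_of_set {0..1}) K \<and> openin T U}"

lemma topspace_path_space [simp]: "topspace (path_space T) = paths T"
proof -
  have "paths T \<in> {{g \<in> paths T. g ` K \<subseteq> U} | K U. compactin (top_of_set {0..1}) K \<and> openin T U}"
    by (auto intro!: exI[of _ "{}"])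
  then show ?thesis
    unfolding path_space_def topology_generated_by_topspace by blast
qed

definition Phi :: "(real \<Rightarrow> 'a) pmf \<Rightarrow> real \<Rightarrow> 'a pmf" where
  "Phi \<mu> = (\<lambda>t\<in>{0..1}. map_pmf (\<lambda>\<alpha>. \<alpha> t) \<mu>)"

text \<open>
  Resolvability only involves the points of \<open>\<B>\<^sub>n(P(X))\<close>, not its topology, so no metric on
  the path space is needed.
\<close>

definition resolvable_paths :: "nat \<Rightarrow> 'a metric \<Rightarrow> (real \<Rightarrow> 'a pmf) set" where
  "resolvable_paths n X =
     {f \<in> paths (mtopology_of (Bsp n X)). \<exists>\<mu> \<in> fin_measures n (paths (mtopology_of X)). f = Phi \<mu>}"

definition RP :: "nat \<Rightarrow> 'a metric \<Rightarrow> (real \<Rightarrow> 'a pmf) topology" where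
  "RP n X = subtopology (path_space (mtopology_of (Bsp n X))) (resolvable_paths n X)"

definition RP0 :: "nat \<Rightarrow> 'a metric \<Rightarrow> 'a \<Rightarrow> (real \<Rightarrow> 'a pmf) topology" where
  "RP0 n X x\<^sub>0 = subtopology (RP n X) {f. f 1 = return_pmf x\<^sub>0}"


subsection \<open>Intertwining invariants\<close>

text \<open>The \<open>m\<close>-th power of a space, as the space of extensional families indexed by \<open>1, \<dots>, m\<close>.\<close>

abbreviation power_space :: "nat \<Rightarrow> 'a topology \<Rightarrow> (nat \<Rightarrow> 'a) topology" where
  "power_space m T \<equiv> product_topology (\<lambda>_. T) {1..m}"

text \<open>The infimum of the empty set in \<^typ>\<open>enat\<close> is \<open>\<infinity>\<close>.\<close>

definition iTC :: "nat \<Rightarrow> 'a metric \<Rightarrow> enat" where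
  "iTC m X = Inf (enat ` {n. \<exists>s.
     continuous_map (power_space m (mtopology_of X)) (RP (n + 1) X) s \<and>
     (\<forall>x \<in> topspace (power_space m (mtopology_of X)). \<forall>i \<in> {1..m}.
        s x ((real i - 1) / (real m - 1)) = return_pmf (x i))})"

definition icat :: "'a metric \<Rightarrow> 'a \<Rightarrow> enat" where
  "icat X x\<^sub>0 = Inf (enat ` {n. \<exists>H.
     continuous_map (mtopology_of X) (RP0 (n + 1) X x\<^sub>0) H \<and>
     (\<forall>x \<in> mspace X. H x 0 = return_pmf x)})"

end

theory Submission
  imports Defs
begin

text \<open>
  Suppose that \<open>H\<close> contracts \<open>X\<^sup>m\<close> to the point \<open>x\<^sub>0\<close> through resolvable paths. Given
  \<open>y\<^sub>1, \<dots>, y\<^sub>m\<^sub>+\<^sub>1\<close> in the group \<open>X\<close>, let \<open>a\<close> be the point of \<open>X\<^sup>m\<close> with coordinates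
  \<open>y\<^sub>1\<inverse> y\<^sub>i\<^sub>+\<^sub>1 x\<^sub>0\<^sub>i\<close>. The map \<open>\<phi>\<^sub>i(z) = y\<^sub>1 z\<^sub>i x\<^sub>0\<^sub>i\<inverse>\<close> from \<open>X\<^sup>m\<close> to \<open>X\<close> sends \<open>a\<close> to \<open>y\<^sub>i\<^sub>+\<^sub>1\<close> and
  \<open>x\<^sub>0\<close> to \<open>y\<^sub>1\<close>. So the image of the path \<open>H(a)\<close> under \<open>\<phi>\<^sub>i\<close> joins the Dirac measure at \<open>y\<^sub>i\<^sub>+\<^sub>1\<close> to
  the one at \<open>y\<^sub>1\<close>. Starting at \<open>y\<^sub>1\<close>, run through these image paths one after the other, each one
  backwards and then forwards: an excursion to \<open>y\<^sub>2\<close> and back, then to \<open>y\<^sub>3\<close> and back, and so on, ending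
  half-way through the last one, at \<open>y\<^sub>m\<^sub>+\<^sub>1\<close>.

  The resulting path of measures is resolvable with no more points than \<open>H(a)\<close>: every path in a
  resolver of \<open>H(a)\<close> ends at \<open>x\<^sub>0\<close>, hence the same recipe turns it into a path in \<open>X\<close>, and these
  paths carry the same weights. Resolvers are needed only pointwise, so nothing depends on choosing
  them continuously.

  The remaining work is to see that the new path depends continuously on \<open>y\<close>. By the exponential
  law (\<open>continuous_map_path_space_eval\<close>, \<open>continuous_map_path_space_curry\<close>) this is joint continuity
  in \<open>y\<close> and the time. The push-forward of a measure is jointly continuous in the measure and the
  map (\<open>continuous_map_map_pmf\<close>), and the excursions fit together because all of them begin and end
  at \<open>y\<^sub>1\<close> (\<open>continuous_map_excursions\<close>).
\<close>

section \<open>Images of finitely supported measures\<close>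

lemma lp_dist_commute: "lp_dist Z p q = lp_dist Z q p"
  by (rule Metric_space.commute[OF Metric_space_Bsp])

lemma finite_in_borel_sets_of:
  assumes "finite A" "A \<subseteq> mspace Z"
  shows "A \<in> borel_sets_of (mtopology_of Z)"
proof -
  have "closedin (mtopology_of Z) A"
    using assms unfolding mtopology_of_def
    by (metis Metric_space.t1_space_mtopology Metric_space_mspace_mdist
        Metric_space.topspace_mtopology t1_space_closedin_finite)
  then have "mspace Z - (mspace Z - A) \<in> borel_sets_of (mtopology_of Z)"
    unfolding borel_sets_of_def topspace_mtopology_of
    by (intro sigma_sets.Compl sigma_sets.Basic) (auto simp: closedin_def)
  then show ?thesis
    using assms(2) by (simp add: double_diff)
qed

lemma lp_dist_leI:
  assumes "0 < \<epsilon>"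
    and "\<And>A. measure_pmf.prob p A \<le> measure_pmf.prob q (mnbhd Z A \<epsilon>) + \<epsilon>"
    and "\<And>A. measure_pmf.prob q A \<le> measure_pmf.prob p (mnbhd Z A \<epsilon>) + \<epsilon>"
  shows "lp_dist Z p q \<le> \<epsilon>"
  unfolding lp_dist_def
  by (rule cInf_lower) (use assms in \<open>auto intro!: bdd_belowI[of _ 0]\<close>)

text \<open>
  Only the trace of \<open>A\<close> on the finite support of \<open>p\<close> matters, and finite sets are Borel. So the
  defining inequality of the Levy--Prokhorov distance extends from Borel sets to all sets \<open>A\<close>; it is
  then available for preimages under arbitrary maps.
\<close>

lemma prob_le_prob_mnbhd:
  assumes p: "p \<in> fin_measures n (mspace Z)" and less: "lp_dist Z p q < \<delta>"
  shows "measure_pmf.prob p A \<le> measure_pmf.prob q (mnbhd Z A \<delta>) + \<delta>"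
proof -
  define S where "S = {\<epsilon>. 0 < \<epsilon> \<and> (\<forall>A \<in> borel_sets_of (mtopology_of Z).
     measure_pmf.prob p A \<le> measure_pmf.prob q (mnbhd Z A \<epsilon>) + \<epsilon> \<and>
     measure_pmf.prob q A \<le> measure_pmf.prob p (mnbhd Z A \<epsilon>) + \<epsilon>)}"
  have "1 \<in> S"
    unfolding S_def by (auto intro!: order_trans[OF measure_pmf.prob_le_1])
  moreover have "Inf S < \<delta>"
    using less by (simp add: lp_dist_def S_def)
  ultimately obtain \<epsilon> where \<epsilon>: "\<epsilon> \<in> S" "\<epsilon> < \<delta>"
    using cInf_lessD[of S \<delta>] by blast
  define B where "B = A \<inter> set_pmf p"
  have "B \<in> borel_sets_of (mtopology_of Z)"
    using p by (intro finite_in_borel_sets_of) (auto simp: B_def fin_measures_def)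
  then have "measure_pmf.prob p B \<le> measure_pmf.prob q (mnbhd Z B \<epsilon>) + \<epsilon>"
    using \<epsilon>(1) by (simp add: S_def)
  also have "measure_pmf.prob q (mnbhd Z B \<epsilon>) \<le> measure_pmf.prob q (mnbhd Z A \<delta>)"
    using \<epsilon>(2) by (intro measure_pmf.finite_measure_mono) (force simp: mnbhd_def B_def)+
  finally show ?thesis
    using \<epsilon>(2) by (simp add: B_def measure_Int_set_pmf)
qed

text \<open>
  A mass that \<open>q\<close> gives to points near \<open>z\<close>, an atom of \<open>p\<close>, is carried by \<open>g\<close> to points near
  \<open>f z\<close>. Closeness of \<open>f\<close> and \<open>g\<close> is therefore needed around the atoms of \<open>p\<close> only, and finitely
  many atoms impose finitely many conditions.
\<close>

lemma lp_dist_map_pmf_le: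
  assumes p: "p \<in> fin_measures n (mspace Z)" and q: "q \<in> fin_measures n (mspace Z)"
    and less: "lp_dist Z p q < \<delta>" and "\<delta> \<le> \<epsilon>" "0 < \<epsilon>"
    and f: "f \<in> mspace Z \<rightarrow> mspace X" and g: "g \<in> mspace Z \<rightarrow> mspace X"
    and close: "\<And>z z'. \<lbrakk>z \<in> set_pmf p; z' \<in> mspace Z; mdist Z z z' < \<delta>\<rbrakk>
                  \<Longrightarrow> mdist X (f z) (g z') < \<epsilon>"
  shows "lp_dist X (map_pmf f p) (map_pmf g q) \<le> \<epsilon>"
proof (rule lp_dist_leI)
  have supp: "set_pmf p \<subseteq> mspace Z" "set_pmf q \<subseteq> mspace Z"
    using p q by (auto simp: fin_measures_def)
  fix A
  have "measure_pmf.prob p (f -` A \<inter> set_pmf p)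
      \<le> measure_pmf.prob q (mnbhd Z (f -` A \<inter> set_pmf p) \<delta>) + \<delta>"
    by (rule prob_le_prob_mnbhd[OF p less])
  also have "measure_pmf.prob q (mnbhd Z (f -` A \<inter> set_pmf p) \<delta>)
      \<le> measure_pmf.prob q (g -` mnbhd X A \<epsilon>)"
    using close g by (intro measure_pmf.finite_measure_mono) (auto simp: mnbhd_def)
  finally show "measure_pmf.prob (map_pmf f p) A
      \<le> measure_pmf.prob (map_pmf g q) (mnbhd X A \<epsilon>) + \<epsilon>"
    using \<open>\<delta> \<le> \<epsilon>\<close> by (simp add: measure_Int_set_pmf)
  have "measure_pmf.prob q (g -` A \<inter> set_pmf q)
      \<le> measure_pmf.prob p (mnbhd Z (g -` A \<inter> set_pmf q) \<delta>) + \<delta>"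
    using less by (intro prob_le_prob_mnbhd[OF q]) (simp add: lp_dist_commute)
  also have "measure_pmf.prob p (mnbhd Z (g -` A \<inter> set_pmf q) \<delta>)
      = measure_pmf.prob p (mnbhd Z (g -` A \<inter> set_pmf q) \<delta> \<inter> set_pmf p)"
    by (simp add: measure_Int_set_pmf)
  also have "\<dots> \<le> measure_pmf.prob p (f -` mnbhd X A \<epsilon>)"
  proof (intro measure_pmf.finite_measure_mono subsetI)
    fix z assume "z \<in> mnbhd Z (g -` A \<inter> set_pmf q) \<delta> \<inter> set_pmf p"
    then obtain z' where z': "g z' \<in> A" "z' \<in> set_pmf q" "mdist Z z' z < \<delta>" "z \<in> set_pmf p"
      by (auto simp: mnbhd_def)
    then have "mdist X (f z) (g z') < \<epsilon>"
      using supp by (intro close) (auto simp: mdist_commute)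
    then show "z \<in> f -` mnbhd X A \<epsilon>"
      using z' supp f by (auto simp: mnbhd_def mdist_commute intro!: bexI[of _ "g z'"])
  qed auto
  finally show "measure_pmf.prob (map_pmf g q) A
      \<le> measure_pmf.prob (map_pmf f p) (mnbhd X A \<epsilon>) + \<epsilon>"
    using \<open>\<delta> \<le> \<epsilon>\<close> by (simp add: measure_Int_set_pmf)
qed (fact \<open>0 < \<epsilon>\<close>)

lemma map_pmf_in_fin_measures:
  assumes "p \<in> fin_measures n S" "f ` S \<subseteq> T"
  shows "map_pmf f p \<in> fin_measures n T"
  using assms card_image_le[of "set_pmf p" f]
  by (auto simp: fin_measures_def image_subset_iff subset_iff)

text \<open>
  For a single map \<open>f\<close> this is the continuous mapping theorem; the extra parameter is what lets a
  measure and the map that moves it vary together.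
\<close>

lemma continuous_map_map_pmf:
  assumes f: "continuous_map (prod_topology Y (mtopology_of Z)) (mtopology_of X) (\<lambda>(y, z). f y z)"
  shows "continuous_map (prod_topology Y (mtopology_of (Bsp n Z))) (mtopology_of (Bsp n X))
           (\<lambda>(y, p). map_pmf (f y) p)"
proof -
  interpret BX: Metric_space "fin_measures n (mspace X)" "lp_dist X"
    by (rule Metric_space_Bsp)
  interpret BZ: Metric_space "fin_measures n (mspace Z)" "lp_dist Z"
    by (rule Metric_space_Bsp)
  interpret MX: Metric_space "mspace X" "mdist X" by simp
  interpret MZ: Metric_space "mspace Z" "mdist Z" by simp
  have BX: "mtopology_of (Bsp n X) = BX.mtopology" and BZ: "mtopology_of (Bsp n Z) = BZ.mtopology"
    by (simp_all add: mtopology_of_def)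
  have MX: "mtopology_of X = MX.mtopology"
    by (simp only: mtopology_of_def)
  have maps: "f y \<in> mspace Z \<rightarrow> mspace X" if "y \<in> topspace Y" for y
    using continuous_map_funspace[OF f] that by (fastforce simp: Pi_iff)
  show ?thesis
    unfolding BX BX.continuous_map_to_metric
  proof (intro ballI allI impI)
    fix w and \<epsilon> :: real
    assume w: "w \<in> topspace (prod_topology Y (mtopology_of (Bsp n Z)))" and "0 < \<epsilon>"
    obtain y p where [simp]: "w = (y, p)" by fastforce
    have y: "y \<in> topspace Y" and p: "p \<in> fin_measures n (mspace Z)"
      using w by auto
    have "\<exists>U \<delta>. openin Y U \<and> y \<in> U \<and> 0 < \<delta> \<and>
            (\<forall>y'\<in>U. \<forall>z'\<in>mspace Z. mdist Z z z' < \<delta> \<longrightarrow> mdist X (f y z) (f y' z') < \<epsilon> / 2)"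
      if "z \<in> set_pmf p" for z
    proof -
      have z: "z \<in> mspace Z"
        using p that by (auto simp: fin_measures_def)
      then have "(y, z) \<in> topspace (prod_topology Y (mtopology_of Z))"
        using y by simp
      then obtain W where W: "openin (prod_topology Y (mtopology_of Z)) W" "(y, z) \<in> W"
          and Wf: "\<forall>v\<in>W. (\<lambda>(y, z). f y z) v \<in> MX.mball (f y z) (\<epsilon> / 2)"
        using f[unfolded MX MX.continuous_map_to_metric, rule_format, OF _ half_gt_zero[OF \<open>0 < \<epsilon>\<close>]]
        by force
      obtain U V where UV: "openin Y U" "openin (mtopology_of Z) V" "y \<in> U" "z \<in> V" "U \<times> V \<subseteq> W"
        using W(1)[unfolded openin_prod_topology_alt, rule_format, OF W(2)] by blast
      then obtain \<delta> where "0 < \<delta>" "MZ.mball z \<delta> \<subseteq> V"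
        unfolding mtopology_of_def MZ.openin_mtopology by blast
      have "mdist X (f y z) (f y' z') < \<epsilon> / 2"
        if "y' \<in> U" "z' \<in> mspace Z" "mdist Z z z' < \<delta>" for y' z'
      proof -
        have "z' \<in> V"
          using that z \<open>MZ.mball z \<delta> \<subseteq> V\<close> by (auto simp: MZ.in_mball)
        then have "(y', z') \<in> W"
          using that(1) UV(5) by blast
        then show ?thesis
          using Wf by (auto simp: MX.in_mball)
      qed
      then show ?thesis
        using UV(1,3) \<open>0 < \<delta>\<close> by (intro exI[of _ U] exI[of _ \<delta>]) simp
    qed
    then obtain U \<delta> where U: "\<And>z. z \<in> set_pmf p \<Longrightarrow> openin Y (U z) \<and> y \<in> U z"
      and \<delta>: "\<And>z. z \<in> set_pmf p \<Longrightarrow> 0 < \<delta> z"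
      and close: "\<And>z y' z'. \<lbrakk>z \<in> set_pmf p; y' \<in> U z; z' \<in> mspace Z; mdist Z z z' < \<delta> z\<rbrakk>
                    \<Longrightarrow> mdist X (f y z) (f y' z') < \<epsilon> / 2"
      by metis
    define d where "d = Min (insert (\<epsilon> / 2) (\<delta> ` set_pmf p))"
    have fin: "finite (set_pmf p)"
      using p by (simp add: fin_measures_def)
    have "0 < d"
      using fin \<delta> \<open>0 < \<epsilon>\<close> by (simp add: d_def)
    moreover have "d \<le> \<epsilon> / 2"
      unfolding d_def using fin by (intro Min_le) auto
    moreover have "d \<le> \<delta> z" if "z \<in> set_pmf p" for z
      unfolding d_def using fin that by (intro Min_le) auto
    ultimately have d: "0 < d" "d \<le> \<epsilon> / 2" "\<And>z. z \<in> set_pmf p \<Longrightarrow> d \<le> \<delta> z"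
      by auto
    define V where "V = (\<Inter>z\<in>set_pmf p. U z)"
    have V: "openin Y V" "y \<in> V"
      using U fin set_pmf_not_empty by (auto simp: V_def intro!: openin_Inter)
    have "map_pmf (f y') q \<in> BX.mball (map_pmf (f y) p) \<epsilon>"
      if y': "y' \<in> V" and q: "q \<in> BZ.mball p d" for y' q
    proof -
      have q': "q \<in> fin_measures n (mspace Z)" "lp_dist Z p q < d"
        using q by (auto simp: BZ.in_mball)
      have y'Y: "y' \<in> topspace Y"
        using V y' openin_subset by blast
      have "lp_dist X (map_pmf (f y) p) (map_pmf (f y') q) \<le> \<epsilon> / 2"
      proof (rule lp_dist_map_pmf_le[OF p q' \<open>d \<le> \<epsilon> / 2\<close>])
        fix z z' assume z: "z \<in> set_pmf p" and "z' \<in> mspace Z" "mdist Z z z' < d"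
        then show "mdist X (f y z) (f y' z') < \<epsilon> / 2"
          using y' d(3)[OF z] by (intro close) (auto simp: V_def)
      qed (use \<open>0 < \<epsilon>\<close> maps y y'Y in auto)
      moreover have "map_pmf (f y) p \<in> fin_measures n (mspace X)"
        using maps[OF y] by (intro map_pmf_in_fin_measures[OF p]) auto
      moreover have "map_pmf (f y') q \<in> fin_measures n (mspace X)"
        using maps[OF y'Y] by (intro map_pmf_in_fin_measures[OF q'(1)]) auto
      ultimately show ?thesis
        using \<open>0 < \<epsilon>\<close> by (simp add: BX.in_mball)
    qed
    moreover have "openin (prod_topology Y (mtopology_of (Bsp n Z))) (V \<times> BZ.mball p d)"
      using V BZ.openin_mball by (simp add: BZ openin_prod_Times_iff)
    moreover have "w \<in> V \<times> BZ.mball p d"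
      using V p d(1) by simp
    ultimately show "\<exists>W. openin (prod_topology Y (mtopology_of (Bsp n Z))) W \<and> w \<in> W \<and>
        (\<forall>v\<in>W. (case v of (y, p) \<Rightarrow> map_pmf (f y) p)
                  \<in> BX.mball (case w of (y, p) \<Rightarrow> map_pmf (f y) p) \<epsilon>)"
      by (intro exI[of _ "V \<times> BZ.mball p d"]) auto
  qed
qed


section \<open>The exponential law for path spaces\<close>

text \<open>
  Evaluation is continuous because the interval is locally compact: a path that is in \<open>U\<close> at time \<open>t\<close>
  stays in \<open>U\<close> during a compact neighbourhood \<open>K\<close> of \<open>t\<close>, and this is an open condition on the path.
\<close>

lemma continuous_map_path_space_eval:
  "continuous_map (prod_topology (path_space T) (top_of_set {0..1})) T (\<lambda>(g, t). g t)"
proof -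
  let ?I = "top_of_set {0..1::real}"
  let ?P = "prod_topology (path_space T) ?I"
  have "openin ?P {w \<in> topspace ?P. (\<lambda>(g, t). g t) w \<in> U}" if U: "openin T U" for U
  proof (subst openin_prod_topology_alt, intro allI impI)
    fix g and t :: real
    assume "(g, t) \<in> {w \<in> topspace ?P. (\<lambda>(g, t). g t) w \<in> U}"
    then have g: "g \<in> paths T" and t: "t \<in> {0..1}" and gt: "g t \<in> U"
      by auto
    have "openin ?I {s \<in> topspace ?I. g s \<in> U}"
      using g U by (intro openin_continuous_map_preimage[where Y = T]) (auto simp: paths_def pathin_def)
    then obtain e where e: "0 < e" "\<forall>s\<in>{0..1}. dist s t < e \<longrightarrow> g s \<in> U"
      using t gt by (auto simp: openin_euclidean_subtopology_iff)
    define K where "K = cball t (e / 2) \<inter> {0..1}"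
    have "compactin ?I K"
      by (auto simp: compactin_subtopology K_def intro: compact_Int)
    then have "openin (path_space T) {g \<in> paths T. g ` K \<subseteq> U}"
      unfolding path_space_def using U by (intro topology_generated_by_Basis) auto
    moreover have "openin ?I (ball t (e / 2) \<inter> {0..1})"
      by (metis Int_commute open_ball openin_open_Int)
    moreover have "g ` K \<subseteq> U"
      using e by (auto simp: K_def dist_commute)
    ultimately show "\<exists>V W. openin (path_space T) V \<and> openin ?I W \<and> g \<in> V \<and> t \<in> W \<and>
        V \<times> W \<subseteq> {w \<in> topspace ?P. (\<lambda>(g, t). g t) w \<in> U}"
      using g t e(1)
      by (intro exI[of _ "{g \<in> paths T. g ` K \<subseteq> U}"] exI[of _ "ball t (e / 2) \<inter> {0..1}"])
        (auto simp: K_def)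
  qed
  moreover have "(\<lambda>(g, t). g t) \<in> topspace ?P \<rightarrow> topspace T"
    by (auto simp: paths_def pathin_def dest!: continuous_map_funspace)
  ultimately show ?thesis
    unfolding continuous_map_def by blast
qed

text \<open>
  The set of parameters \<open>y\<close> for which the path stays in \<open>U\<close> during \<open>K\<close> is open because the
  projection along the compact interval is a closed map.
\<close>

lemma continuous_map_path_space_curry:
  assumes F: "continuous_map (prod_topology Y (top_of_set {0..1})) T (\<lambda>(y, t). F y t)"
  shows "continuous_map Y (path_space T) (\<lambda>y. \<lambda>t\<in>{0..1}. F y t)"
proof -
  let ?I = "top_of_set {0..1::real}"
  let ?P = "prod_topology Y ?I"
  have path: "(\<lambda>t\<in>{0..1}. F y t) \<in> paths T" if y: "y \<in> topspace Y" for y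
  proof -
    have "continuous_map ?I ?P (\<lambda>t. (y, t))"
      using y by (simp add: continuous_map_pairwise o_def)
    from continuous_map_compose[OF this F] have "continuous_map ?I T (\<lambda>t. F y t)"
      by (simp add: o_def)
    then have "continuous_map ?I T (\<lambda>t\<in>{0..1}. F y t)"
      by (rule continuous_map_eq) simp
    then show ?thesis
      by (simp add: paths_def pathin_def)
  qed
  show ?thesis
    unfolding path_space_def
  proof (rule continuous_on_generated_topo)
    fix S assume "S \<in> {{g \<in> paths T. g ` K \<subseteq> U} | K U. compactin ?I K \<and> openin T U}"
    then obtain K U where S: "S = {g \<in> paths T. g ` K \<subseteq> U}"
      and K: "compactin ?I K" and U: "openin T U"
      by blast
    have K01: "K \<subseteq> {0..1}"
      using compactin_subset_topspace[OF K] by simp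
    define C where "C = {w \<in> topspace ?P. (\<lambda>(y, t). F y t) w \<in> topspace T - U}
                          \<inter> {w \<in> topspace ?P. snd w \<in> K}"
    have "closedin ?I K"
      using K by (intro compactin_imp_closedin) (auto simp: Hausdorff_space_subtopology)
    then have "closedin ?P C"
      unfolding C_def using U
      by (intro closedin_Int closedin_continuous_map_preimage[OF F]
          closedin_continuous_map_preimage[OF continuous_map_snd]) auto
    moreover have "closed_map ?P Y fst"
      by (rule closed_map_fst) (simp add: compact_space_subtopology)
    ultimately have "closedin Y (fst ` C)"
      by (simp add: closed_map_def)
    then have "openin Y (topspace Y - fst ` C)"
      by blast
    moreover have "(\<lambda>t\<in>{0..1}. F y t) \<in> S \<longleftrightarrow> y \<notin> fst ` C" if y: "y \<in> topspace Y" for y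
    proof -
      have "F y t \<in> topspace T" if "t \<in> K" for t
        using continuous_map_funspace[OF F] K01 y that by (fastforce simp: Pi_iff)
      then have "y \<in> fst ` C \<longleftrightarrow> (\<exists>t\<in>K. F y t \<notin> U)"
        using K01 y by (force simp: C_def)
      then show ?thesis
        using path[OF y] K01 by (auto simp: S image_subset_iff)
    qed
    then have "(\<lambda>y. \<lambda>t\<in>{0..1}. F y t) -` S \<inter> topspace Y = topspace Y - fst ` C"
      by blast
    ultimately show "openin Y ((\<lambda>y. \<lambda>t\<in>{0..1}. F y t) -` S \<inter> topspace Y)"
      by simp
  next
    have "paths T \<in> {{g \<in> paths T. g ` K \<subseteq> U} | K U. compactin ?I K \<and> openin T U}"
      by (auto intro!: exI[of _ "{}"])
    then show "(\<lambda>y. \<lambda>t\<in>{0..1}. F y t) ` topspace Y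
        \<subseteq> \<Union>{{g \<in> paths T. g ` K \<subseteq> U} | K U. compactin ?I K \<and> openin T U}"
      using path by blast
  qed
qed


section \<open>Concatenating excursions from a common base\<close>

text \<open>
  The \<open>i\<close>-th excursion, \<open>i \<ge> 1\<close>, takes place between the times \<open>i - 1/2\<close> and \<open>i + 1/2\<close>, so the
  index is the integer nearest to \<open>s\<close>. There is no excursion before time \<open>1/2\<close>; this stretch is
  given to the first one, which is still at the base then.
\<close>

definition excursion_index :: "real \<Rightarrow> nat" where
  "excursion_index s = max 1 (nat \<lceil>s - 1/2\<rceil>)"

text \<open>
  The parameter at which the \<open>i\<close>-th path is evaluated at time \<open>s\<close>: it runs from \<open>1\<close> (the base) to
  \<open>0\<close> (the far end, reached at time \<open>s = i\<close>) and back.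
\<close>

definition tent :: "nat \<Rightarrow> real \<Rightarrow> real" where
  "tent i s = min 1 (2 * \<bar>s - real i\<bar>)"

lemma tent_bounds: "tent i s \<in> {0..1}"
  by (auto simp: tent_def)

lemma tent_eq_1: "1/2 \<le> \<bar>s - real i\<bar> \<Longrightarrow> tent i s = 1"
  by (simp add: tent_def)

lemma continuous_map_tent: "continuous_map euclideanreal (top_of_set {0..1}) (tent i)"
  unfolding continuous_map_in_subtopology
  by (auto simp: tent_def intro!: continuous_intros)

lemma excursion_index_range: "1 \<le> m \<Longrightarrow> s \<le> real m \<Longrightarrow> excursion_index s \<in> {1..m}"
  by (auto simp: excursion_index_def ceiling_le_iff nat_le_iff)

lemma excursion_index_of_nat: "1 \<le> i \<Longrightarrow> excursion_index (real i) = i"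
proof -
  assume "1 \<le> i"
  moreover have "\<lceil>real i - 1/2\<rceil> = int i"
    by (rule ceiling_unique) auto
  ultimately show ?thesis
    by (simp add: excursion_index_def)
qed

lemma excursion_index_upper: "s \<le> real (excursion_index s) + 1/2"
proof -
  have "s - 1/2 \<le> real (nat \<lceil>s - 1/2\<rceil>)"
    by (rule real_nat_ceiling_ge)
  also have "\<dots> \<le> real (excursion_index s)"
    by (simp only: excursion_index_def of_nat_le_iff max.cobounded2)
  finally show ?thesis
    by linarith
qed

lemma excursion_index_lower: "excursion_index s \<noteq> 1 \<Longrightarrow> real (excursion_index s) - 1/2 \<le> s"
proof -
  assume "excursion_index s \<noteq> 1"
  then have "real (excursion_index s) = of_int \<lceil>s - 1/2\<rceil>"
    by (auto simp: excursion_index_def max_def split: if_splits)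
  then show ?thesis
    by linarith
qed

text \<open>
  Two excursions meet only at half-integral times, where both are at the base \<open>e\<close>; so finitely many
  of them, each defined on its own closed piece, can be pasted.
\<close>

lemma continuous_map_excursions:
  assumes "1 \<le> m" and \<tau>: "continuous_map A euclideanreal \<tau>"
    and range: "\<And>x. x \<in> topspace A \<Longrightarrow> \<tau> x \<in> {0..real m}"
    and cont: "\<And>i. i \<in> {1..m} \<Longrightarrow> continuous_map A B (g i)"
    and base: "\<And>i x. \<lbrakk>i \<in> {1..m}; x \<in> topspace A; 1/2 \<le> \<bar>\<tau> x - real i\<bar>\<rbrakk> \<Longrightarrow> g i x = e x"
  shows "continuous_map A B (\<lambda>x. g (excursion_index (\<tau> x)) x)"
proof (rule pasting_lemma_closed)
  \<comment> \<open>The pieces have to cover the initial stretch \<open>[0, 1/2]\<close> as well.\<close>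
  define T where "T i = {x \<in> topspace A. \<tau> x \<in> {if i = 1 then 0 else real i - 1/2 .. real i + 1/2}}"
    for i :: nat
  show "finite {1..m}" by simp
  show "closedin A (T i)" for i
    unfolding T_def by (rule closedin_continuous_map_preimage[OF \<tau>]) simp
  show "continuous_map (subtopology A (T i)) B (g i)" if "i \<in> {1..m}" for i
    using cont[OF that] by (rule continuous_map_from_subtopology)
  show "g i x = g j x" if "i \<in> {1..m}" "j \<in> {1..m}" "x \<in> topspace A \<inter> T i \<inter> T j" for i j x
  proof -
    have *: "g i x = g j x"
      if "i < j" "i \<in> {1..m}" "j \<in> {1..m}" "x \<in> topspace A \<inter> T i \<inter> T j" for i j
    proof -
      have "real j \<ge> real i + 1"
        using that(1) by linarith
      moreover have "real j - 1/2 \<le> \<tau> x" "\<tau> x \<le> real i + 1/2"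
        using that by (auto simp: T_def)
      ultimately have "1/2 \<le> \<bar>\<tau> x - real i\<bar>" "1/2 \<le> \<bar>\<tau> x - real j\<bar>"
        by linarith+
      then show ?thesis
        using that base by simp
    qed
    show ?thesis
    proof (cases i j rule: linorder_cases)
      case less
      then show ?thesis using that by (intro *)
    next
      case greater
      then show ?thesis using that by (intro *[symmetric]) auto
    qed simp
  qed
  fix x assume x: "x \<in> topspace A"
  have "excursion_index (\<tau> x) \<in> {1..m}"
    using range[OF x] excursion_index_range[OF \<open>1 \<le> m\<close>] by simp
  moreover have "x \<in> T (excursion_index (\<tau> x))"
  proof -
    have "0 \<le> \<tau> x"
      using range[OF x] by simp
    moreover note excursion_index_lower[of "\<tau> x"] excursion_index_upper[of "\<tau> x"]
    ultimately show ?thesis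
      using x by (simp add: T_def)
  qed
  ultimately show "\<exists>j. j \<in> {1..m} \<and> x \<in> T j \<and> g (excursion_index (\<tau> x)) x = g j x"
    by blast
qed


section \<open>Topological groups\<close>

lemma topological_group_mult:
  assumes "topological_group G T" "continuous_map A T f" "continuous_map A T g"
  shows "continuous_map A T (\<lambda>x. f x \<otimes>\<^bsub>G\<^esub> g x)"
proof -
  have "continuous_map A (prod_topology T T) (\<lambda>x. (f x, g x))"
    using assms by (simp add: continuous_map_pairwise o_def)
  moreover have "continuous_map (prod_topology T T) T (\<lambda>(x, y). x \<otimes>\<^bsub>G\<^esub> y)"
    using assms(1) by (simp add: topological_group_def)
  ultimately show ?thesis
    by (auto dest: continuous_map_compose simp: o_def)
qed

lemma topological_group_inv:
  assumes "topological_group G T" "continuous_map A T f"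
  shows "continuous_map A T (\<lambda>x. inv\<^bsub>G\<^esub> f x)"
  using assms continuous_map_compose[of A T f T "\<lambda>x. inv\<^bsub>G\<^esub> x"]
  by (simp add: topological_group_def o_def)

section \<open>From a contraction of the power to a motion through given points\<close>

theorem proposition4p20:
  fixes G :: "('a, 'b) monoid_scheme"
    and X :: "'a metric"
    and Xm :: "(nat \<Rightarrow> 'a) metric"
    and x\<^sub>0 :: "nat \<Rightarrow> 'a"
    and m :: nat
  assumes "topological_group G (mtopology_of X)"
    and "path_connected_space (mtopology_of X)"
    and "ANR_space (mtopology_of X)"
    and "m \<ge> 1"
    and "mtopology_of Xm = power_space m (mtopology_of X)"
    and "x\<^sub>0 \<in> mspace Xm"
  shows "iTC (m + 1) X \<le> icat Xm x\<^sub>0"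
proof -
  let ?T = "mtopology_of X"
  let ?I = "top_of_set {0..1::real}"
  let ?Y = "power_space (m + 1) ?T"
  note tg = assms(1) and Xm = assms(5)
  interpret G: group G
    using tg by (simp add: topological_group_def)
  have carrier: "mspace X = carrier G"
    using tg by (simp add: topological_group_def)
  have mspace_Xm: "mspace Xm = {1..m} \<rightarrow>\<^sub>E carrier G"
    using arg_cong[OF Xm, of topspace] carrier by simp
  have x0: "x\<^sub>0 i \<in> carrier G" if "i \<in> {1..m}" for i
    using assms(6) that by (auto simp: mspace_Xm)
  have Y: "y i \<in> carrier G" if "y \<in> topspace ?Y" "i \<in> {1..m+1}" for y i
    using that by (auto simp: carrier PiE_iff)
  \<comment> \<open>The factor \<open>x\<^sub>0 i\<close> cancels against the one in \<open>\<phi>\<close>, which is there because the basepoint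
      need not be the neutral element.\<close>
  define a where "a y = (\<lambda>i\<in>{1..m}. inv\<^bsub>G\<^esub> y 1 \<otimes>\<^bsub>G\<^esub> y (i + 1) \<otimes>\<^bsub>G\<^esub> x\<^sub>0 i)" for y
  define \<phi> where "\<phi> i y z = y 1 \<otimes>\<^bsub>G\<^esub> (z i \<otimes>\<^bsub>G\<^esub> inv\<^bsub>G\<^esub> x\<^sub>0 i)" for i and y z :: "nat \<Rightarrow> 'a"
  have \<phi>_x0: "\<phi> i y x\<^sub>0 = y 1" if "y \<in> topspace ?Y" "i \<in> {1..m}" for i y
    using Y[OF that(1), of 1] x0[OF that(2)] by (simp add: \<phi>_def)
  have \<phi>_a: "\<phi> i y (a y) = y (i + 1)" if "y \<in> topspace ?Y" "i \<in> {1..m}" for i y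
  proof -
    have in_G: "y 1 \<in> carrier G" "y (i + 1) \<in> carrier G" "x\<^sub>0 i \<in> carrier G"
      using Y[OF that(1)] x0 that(2) by auto
    then have "y 1 \<otimes>\<^bsub>G\<^esub> (inv\<^bsub>G\<^esub> y 1 \<otimes>\<^bsub>G\<^esub> y (i + 1)) = y (i + 1)"
      by (simp flip: G.m_assoc)
    then show ?thesis
      using in_G that(2) by (simp add: \<phi>_def a_def G.m_assoc)
  qed
  have a_cont: "continuous_map ?Y (mtopology_of Xm) a"
    unfolding Xm continuous_map_componentwise a_def
    by (auto intro!: topological_group_mult[OF tg] topological_group_inv[OF tg]
        continuous_map_product_projection simp: x0 carrier)
  have \<phi>_cont: "continuous_map (prod_topology ?Y (mtopology_of Xm)) ?T (\<lambda>(y, z). \<phi> i y z)"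
    if i: "i \<in> {1..m}" for i
  proof -
    have "continuous_map (prod_topology ?Y (power_space m ?T)) ?T (\<lambda>w. fst w 1)"
      by (rule continuous_map_compose[OF continuous_map_fst, unfolded o_def])
        (rule continuous_map_product_projection, simp)
    moreover have "continuous_map (prod_topology ?Y (power_space m ?T)) ?T (\<lambda>w. snd w i)"
      using i by (intro continuous_map_compose[OF continuous_map_snd, unfolded o_def]
          continuous_map_product_projection)
    ultimately show ?thesis
      unfolding Xm \<phi>_def case_prod_unfold
      using x0[OF i] by (intro topological_group_mult[OF tg]) (auto simp: carrier)
  qed
  have "\<exists>s. continuous_map ?Y (RP (n + 1) X) s \<and>
     (\<forall>y \<in> topspace ?Y. \<forall>i \<in> {1..m+1}. s y ((real i - 1) / (real (m + 1) - 1)) = return_pmf (y i))"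
    if H: "continuous_map (mtopology_of Xm) (RP0 (n + 1) Xm x\<^sub>0) H"
      and H0: "\<forall>x \<in> mspace Xm. H x 0 = return_pmf x" for n H
  proof -
    let ?BXm = "mtopology_of (Bsp (n + 1) Xm)" and ?BX = "mtopology_of (Bsp (n + 1) X)"
    have a_in: "a y \<in> mspace Xm" if "y \<in> topspace ?Y" for y
      using continuous_map_funspace[OF a_cont] that by auto
    have H_cont: "continuous_map (mtopology_of Xm) (path_space ?BXm) H"
      and H_res: "H x \<in> resolvable_paths (n + 1) Xm" and H1: "H x 1 = return_pmf x\<^sub>0"
      if "x \<in> mspace Xm" for x
      using H that unfolding RP0_def RP_def continuous_map_in_subtopology by auto
    \<comment> \<open>The interval is stretched to length \<open>m\<close>, so that the prescribed times become integers.\<close>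
    define step where "step i y t = map_pmf (\<phi> i y) (H (a y) (tent i (real m * t)))" for i y t
    define s where "s y = (\<lambda>t\<in>{0..1}. step (excursion_index (real m * t)) y t)" for y
    have time: "continuous_map ?I euclideanreal (\<lambda>t. real m * t)"
      by (auto intro!: continuous_intros)
    have step_cont: "continuous_map (prod_topology ?Y ?I) ?BX (\<lambda>(y, t). step i y t)"
      if i: "i \<in> {1..m}" for i
    proof -
      have "continuous_map ?I ?I (\<lambda>t. tent i (real m * t))"
        using continuous_map_compose[OF time continuous_map_tent] by (simp add: o_def)
      then have "continuous_map (prod_topology ?Y ?I) ?I (\<lambda>w. tent i (real m * snd w))"
        by (rule continuous_map_compose[OF continuous_map_snd, unfolded o_def])
      moreover have "continuous_map ?Y (path_space ?BXm) (\<lambda>y. H (a y))"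
        using continuous_map_compose[OF a_cont H_cont] assms(6) by (simp add: o_def)
      then have "continuous_map (prod_topology ?Y ?I) (path_space ?BXm) (\<lambda>w. H (a (fst w)))"
        by (rule continuous_map_compose[OF continuous_map_fst, unfolded o_def])
      ultimately have "continuous_map (prod_topology ?Y ?I) (prod_topology (path_space ?BXm) ?I)
          (\<lambda>w. (H (a (fst w)), tent i (real m * snd w)))"
        by (simp add: continuous_map_pairwise o_def)
      from continuous_map_compose[OF this continuous_map_path_space_eval]
      have "continuous_map (prod_topology ?Y ?I) ?BXm (\<lambda>w. H (a (fst w)) (tent i (real m * snd w)))"
        by (simp add: o_def)
      then have "continuous_map (prod_topology ?Y ?I) (prod_topology ?Y ?BXm)
          (\<lambda>w. (fst w, H (a (fst w)) (tent i (real m * snd w))))"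
        by (simp add: continuous_map_pairwise o_def continuous_map_fst)
      from continuous_map_compose[OF this continuous_map_map_pmf[OF \<phi>_cont[OF i]]]
      show ?thesis
        by (simp add: o_def step_def case_prod_unfold)
    qed
    have "continuous_map (prod_topology ?Y ?I) ?BX
        (\<lambda>w. (\<lambda>i (y, t). step i y t) (excursion_index (real m * snd w)) w)"
    proof (rule continuous_map_excursions[OF assms(4), where e = "\<lambda>w. return_pmf (fst w 1)"])
      show "continuous_map (prod_topology ?Y ?I) euclideanreal (\<lambda>w. real m * snd w)"
        using continuous_map_compose[OF continuous_map_snd time] by (simp add: o_def)
    next
      fix i assume "i \<in> {1..m}"
      then show "continuous_map (prod_topology ?Y ?I) ?BX (\<lambda>(y, t). step i y t)"
        by (rule step_cont)
    next
      fix i w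
      assume i: "i \<in> {1..m}" and w: "w \<in> topspace (prod_topology ?Y ?I)"
        and half: "1/2 \<le> \<bar>real m * snd w - real i\<bar>"
      then have "fst w \<in> topspace ?Y"
        by auto
      then show "(\<lambda>(y, t). step i y t) w = return_pmf (fst w 1)"
        using tent_eq_1[OF half] H1[OF a_in] \<phi>_x0 i by (simp add: step_def case_prod_unfold)
    qed (auto simp: mult_left_le)
    then have "continuous_map (prod_topology ?Y ?I) ?BX
        (\<lambda>(y, t). step (excursion_index (real m * t)) y t)"
      by (simp add: case_prod_unfold)
    from continuous_map_path_space_curry[OF this]
    have s_cont: "continuous_map ?Y (path_space ?BX) s"
      by (simp add: s_def[abs_def])
    have s_res: "s y \<in> resolvable_paths (n + 1) X" if y: "y \<in> topspace ?Y" for y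
    proof -
      obtain \<mu> where \<mu>: "\<mu> \<in> fin_measures (n + 1) (paths (mtopology_of Xm))" and H\<mu>: "H (a y) = Phi \<mu>"
        using H_res[OF a_in[OF y]] by (auto simp: resolvable_paths_def)
      define leg where "leg \<alpha> i t = \<phi> i y (\<alpha> (tent i (real m * t)))" for \<alpha> i t
      define W where "W \<alpha> = (\<lambda>t\<in>{0..1}. leg \<alpha> (excursion_index (real m * t)) t)" for \<alpha>
      have W: "W \<alpha> \<in> paths ?T" if \<alpha>: "\<alpha> \<in> set_pmf \<mu>" for \<alpha>
      proof -
        have \<alpha>_cont: "continuous_map ?I (mtopology_of Xm) \<alpha>"
          using \<mu> \<alpha> by (auto simp: fin_measures_def paths_def pathin_def)
        have "set_pmf (map_pmf (\<lambda>\<alpha>. \<alpha> 1) \<mu>) = {x\<^sub>0}"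
          using H1[OF a_in[OF y]] by (simp add: H\<mu> Phi_def)
        \<comment> \<open>A Dirac measure at time \<open>1\<close> forces every path of the resolver to end there.\<close>
        then have \<alpha>1: "\<alpha> 1 = x\<^sub>0"
          using \<alpha> by auto
        have "continuous_map ?I ?T (\<lambda>t. leg \<alpha> (excursion_index (real m * t)) t)"
        proof (rule continuous_map_excursions[OF assms(4) time, where e = "\<lambda>t. y 1"])
          fix i assume i: "i \<in> {1..m}"
          have "continuous_map ?I ?I (\<lambda>t. tent i (real m * t))"
            using continuous_map_compose[OF time continuous_map_tent] by (simp add: o_def)
          from continuous_map_compose[OF this \<alpha>_cont]
          have "continuous_map ?I (prod_topology ?Y (mtopology_of Xm))
              (\<lambda>t. (y, \<alpha> (tent i (real m * t))))"
            using y by (simp add: continuous_map_pairwise o_def)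
          from continuous_map_compose[OF this \<phi>_cont[OF i]]
          show "continuous_map ?I ?T (leg \<alpha> i)"
            by (simp add: o_def leg_def[abs_def])
        qed (auto simp: leg_def tent_eq_1 \<alpha>1 \<phi>_x0[OF y] mult_left_le)
        then have "continuous_map ?I ?T (W \<alpha>)"
          by (rule continuous_map_eq) (simp add: W_def)
        then show ?thesis
          by (simp add: paths_def pathin_def W_def)
      qed
      have "map_pmf W \<mu> \<in> fin_measures (n + 1) (paths ?T)"
        using \<mu> W by (intro map_pmf_in_fin_measures[where S = "set_pmf \<mu>"])
          (auto simp: fin_measures_def)
      moreover have "s y = Phi (map_pmf W \<mu>)"
        using tent_bounds
        by (auto simp: s_def Phi_def step_def H\<mu> W_def leg_def map_pmf_comp fun_eq_iff)
      moreover have "s y \<in> paths ?BX"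
        using continuous_map_funspace[OF s_cont] y by auto
      ultimately show ?thesis
        by (auto simp: resolvable_paths_def)
    qed
    have "continuous_map ?Y (RP (n + 1) X) s"
      unfolding RP_def using s_cont s_res by (auto intro: continuous_map_into_subtopology)
    moreover have "s y ((real i - 1) / (real (m + 1) - 1)) = return_pmf (y i)"
      if y: "y \<in> topspace ?Y" and i: "i \<in> {1..m+1}" for y i
    proof -
      define t where "t = (real i - 1) / (real (m + 1) - 1)"
      have t: "t \<in> {0..1}" and mt: "real m * t = real (i - 1)"
        using i assms(4) by (auto simp: t_def field_simps of_nat_diff)
      have "step (excursion_index (real m * t)) y t = return_pmf (y i)"
      proof (cases "i = 1")
        case True
        then show ?thesis
          using assms(4) H1[OF a_in[OF y]] \<phi>_x0[OF y, of 1]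
          by (simp add: step_def mt excursion_index_def tent_eq_1)
      next
        case False
        then have j: "i - 1 \<in> {1..m}"
          using i by auto
        then have "excursion_index (real m * t) = i - 1"
          unfolding mt by (intro excursion_index_of_nat) simp
        then show ?thesis
          using j H0 a_in[OF y] \<phi>_a[OF y j] i by (simp add: step_def mt tent_def)
      qed
      then show ?thesis
        unfolding t_def[symmetric] using t by (simp add: s_def)
    qed
    ultimately show ?thesis
      by blast
  qed
  then show ?thesis
    unfolding iTC_def icat_def by (intro Inf_superset_mono image_mono) blast
qed

end
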